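(* For any distribution $\mu$ over $\{0,1\}^V$, any $\theta\in(0,1)$ and any $\epsilon\in(0,1)$, if $T_1\ge T^{\mathrm{FD}}_{\mathrm{mix}}(\mu,\theta,\frac\epsilon2)$ and $T_2\ge T^{\mathrm{tilted}}_{\mathrm{mix}}(\mu,\theta,\frac{\epsilon}{2T_1})$, then the output $X=\mathsf{contr}(X^{(T_1T_2)}_{\mathrm{alg}})$ of the algorithm $\mathcal A_\mu(\theta,T_1,T_2)$ satisfies $d_{\mathrm{TV}}(X,\mu)\le\epsilon$.
   Context: Tilted distribution $(\theta*\mu)(\sigma)\propto\mu(\sigma)\theta^{\|\sigma\|_1}$; for $\Lambda\subseteq V$, $(\theta*\mu)^{\mathbf 1_{\Lambda}}$ is it conditioned on all coordinates in $\Lambda$ being 1; $\mu_\Lambda$ is the marginal on $\Lambda$. Glauber dynamics $P$ on $\nu$: pick $v$ uniformly, resample $X_v\sim\nu_v^{X_{V\setminus\{v\}}}$; $T^{\mathrm{GD}}_{\mathrm{mix}}(\nu,\epsilon)=\max_{X:\nu(X)>0}\min\{t:d_{\mathrm{TV}}(P^t(X,\cdot),\nu)\le\epsilon\}$; $T^{\mathrm{tilted}}_{\mathrm{mix}}(\mu,\theta,\epsilon)=\max\{T^{\mathrm{GD}}_{\mathrm{mix}}((\theta*\mu)^{\mathbf 1_\Lambda},\epsilon):\mu_\Lambda(\mathbf 1_\Lambda)>0\}$. Field dynamics $P_{\theta,\mu}$: from $X$, build random $S\subseteq V$ including each $v$ independently with probability $\theta$ if $X_v=1$, $1$ if $X_v=0$;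 resample $X\sim(\theta*\mu)^{\mathbf 1_{V\setminus S}}$. $T^{\mathrm{FD}}_{\mathrm{mix}}(\mu,\theta,\epsilon)=\max_{X\in\mathrm{supp}\,\mu}\min\{t:d_{\mathrm{TV}}(P^t_{\theta,\mu}(X,\cdot),\mu)\le\epsilon\}$. $\mathsf{lift}:\{0,1\}^V\to\{0,1,\star\}^V$ is random: independently per coordinate, $0\mapsto0$, and $1\mapsto\star$ with probability $1-\theta$, $1\mapsto1$ with probability $\theta$. $\mathsf{contr}:\{0,1,\star\}^V\to\{0,1\}^V$ maps $0\mapsto0$ and $1,\star\mapsto1$ coordinatewise. Algorithm $\mathcal A_\mu(\theta,T_1,T_2)$: set $X=\mathsf{lift}(\mathbf 1_V)$; repeat $T_1$ times: (a) $X\gets\mathsf{contr}(X)$; (b) $X\gets\mathsf{lift}(X)$, $S=\{v:X_v\ne\star\}$; (c) repeat $T_2$ times: pick $v\in V$ uniformly; if $v\in S$ resample $X_v\sim(\theta*\mu)_v^{\sigma_{V\setminus\{v\}}}$ with $\sigma=\mathsf{contr}(X)$, otherwise keep $X_v=\star$. $X^{(0)}_{\mathrm{alg}}=\mathsf{lift}(\mathbf 1_V)$ is the initial state and $X^{(t)}_{\mathrm{alg}}$ is the state after the $t$-th single-site step in (c); the output is $\mathsf{contr}(X^{(T_1T_2)}_{\mathrm{alg}})$. *)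

theory Defs
  imports "HOL-Probability.Probability"
begin

text \<open>Configurations in {0,1}^V are functions V => bool (True = 1), with V a finite type.\<close>

datatype spin = Zero | One | Star

definition tv_dist :: "'a pmf \<Rightarrow> 'a pmf \<Rightarrow> real" where
  "tv_dist p q = (SUP A. \<bar>measure_pmf.prob p A - measure_pmf.prob q A\<bar>)"

primrec kernel_pow :: "('a \<Rightarrow> 'a pmf) \<Rightarrow> nat \<Rightarrow> 'a \<Rightarrow> 'a pmf" where
  "kernel_pow K 0 x = return_pmf x"
| "kernel_pow K (Suc n) x = bind_pmf (kernel_pow K n x) K"

text \<open>max over starting states x in S of min{t. d_TV(P^t(x,.), pi) <= eps}; infinity if no such t\<close>
definition mix_time :: "(nat \<Rightarrow> 'a \<Rightarrow> 'a pmf) \<Rightarrow> 'a pmf \<Rightarrow> 'a set \<Rightarrow> real \<Rightarrow> enat" where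
  "mix_time Pt \<pi> S eps = (SUP x\<in>S. INF t\<in>{t. tv_dist (Pt t x) \<pi> \<le> eps}. enat t)"

definition ones :: "('v::finite \<Rightarrow> bool) \<Rightarrow> nat" where
  "ones \<sigma> = card {v. \<sigma> v}"

definition tilt :: "real \<Rightarrow> ('v::finite \<Rightarrow> bool) pmf \<Rightarrow> ('v \<Rightarrow> bool) pmf" where
  "tilt \<theta> \<mu> = embed_pmf (\<lambda>\<sigma>. pmf \<mu> \<sigma> * \<theta> ^ ones \<sigma> /
        (\<Sum>\<tau>\<in>UNIV. pmf \<mu> \<tau> * \<theta> ^ ones \<tau>))"

definition pin1 :: "('v::finite \<Rightarrow> bool) pmf \<Rightarrow> 'v set \<Rightarrow> ('v \<Rightarrow> bool) pmf" where
  "pin1 \<nu> \<Lambda> = cond_pmf \<nu> {\<sigma>. \<forall>v\<in>\<Lambda>. \<sigma> v}"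

definition marg1 :: "('v::finite \<Rightarrow> bool) pmf \<Rightarrow> 'v set \<Rightarrow> real" where
  "marg1 \<mu> \<Lambda> = measure_pmf.prob \<mu> {\<sigma>. \<forall>v\<in>\<Lambda>. \<sigma> v}"

text \<open>conditional law of the configuration given all coordinates except v agree with X
  (the v-coordinate of it is nu_v^{X_{V-v}})\<close>
definition cond_off :: "('v::finite \<Rightarrow> bool) pmf \<Rightarrow> 'v \<Rightarrow> ('v \<Rightarrow> bool) \<Rightarrow> ('v \<Rightarrow> bool) pmf" where
  "cond_off \<nu> v X = cond_pmf \<nu> {Y. \<forall>u. u \<noteq> v \<longrightarrow> Y u = X u}"

definition gd_step :: "('v::finite \<Rightarrow> bool) pmf \<Rightarrow> ('v \<Rightarrow> bool) \<Rightarrow> ('v \<Rightarrow> bool) pmf" where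
  "gd_step \<nu> X = bind_pmf (pmf_of_set UNIV)
     (\<lambda>v. map_pmf (\<lambda>Y. X(v := Y v)) (cond_off \<nu> v X))"

definition T_GD :: "('v::finite \<Rightarrow> bool) pmf \<Rightarrow> real \<Rightarrow> enat" where
  "T_GD \<nu> eps = mix_time (kernel_pow (gd_step \<nu>)) \<nu> (set_pmf \<nu>) eps"

definition T_tilted :: "('v::finite \<Rightarrow> bool) pmf \<Rightarrow> real \<Rightarrow> real \<Rightarrow> enat" where
  "T_tilted \<mu> \<theta> eps = (SUP \<Lambda>\<in>{\<Lambda>. marg1 \<mu> \<Lambda> > 0}. T_GD (pin1 (tilt \<theta> \<mu>) \<Lambda>) eps)"

text \<open>one step of field dynamics; S is given by its indicator function\<close>
definition fd_step :: "real \<Rightarrow> ('v::finite \<Rightarrow> bool) pmf \<Rightarrow> ('v \<Rightarrow> bool) \<Rightarrow> ('v \<Rightarrow> bool) pmf" where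
  "fd_step \<theta> \<mu> X = bind_pmf
     (Pi_pmf UNIV False (\<lambda>v. if X v then bernoulli_pmf \<theta> else return_pmf True))
     (\<lambda>S. pin1 (tilt \<theta> \<mu>) {v. \<not> S v})"

definition T_FD :: "('v::finite \<Rightarrow> bool) pmf \<Rightarrow> real \<Rightarrow> real \<Rightarrow> enat" where
  "T_FD \<mu> \<theta> eps = mix_time (kernel_pow (fd_step \<theta> \<mu>)) \<mu> (set_pmf \<mu>) eps"

definition lift :: "real \<Rightarrow> ('v::finite \<Rightarrow> bool) \<Rightarrow> ('v \<Rightarrow> spin) pmf" where
  "lift \<theta> \<sigma> = Pi_pmf UNIV Zero
     (\<lambda>v. if \<sigma> v then map_pmf (\<lambda>b. if b then One else Star) (bernoulli_pmf \<theta>)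
          else return_pmf Zero)"

definition contr :: "('v \<Rightarrow> spin) \<Rightarrow> ('v \<Rightarrow> bool)" where
  "contr X = (\<lambda>v. X v \<noteq> Zero)"

text \<open>single-site step (c) of the algorithm; v is in S iff X v is not a star\<close>
definition alg_step :: "real \<Rightarrow> ('v::finite \<Rightarrow> bool) pmf \<Rightarrow> ('v \<Rightarrow> spin) \<Rightarrow> ('v \<Rightarrow> spin) pmf" where
  "alg_step \<theta> \<mu> X = bind_pmf (pmf_of_set UNIV)
     (\<lambda>v. if X v = Star then return_pmf X
          else map_pmf (\<lambda>Y. X(v := (if Y v then One else Zero)))
                 (cond_off (tilt \<theta> \<mu>) v (contr X)))"

definition alg_round :: "real \<Rightarrow> ('v::finite \<Rightarrow> bool) pmf \<Rightarrow> nat \<Rightarrow> ('v \<Rightarrow> spin) \<Rightarrow> ('v \<Rightarrow> spin) pmf" where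
  "alg_round \<theta> \<mu> T2 X = bind_pmf (lift \<theta> (contr X)) (kernel_pow (alg_step \<theta> \<mu>) T2)"

definition alg_output :: "('v::finite \<Rightarrow> bool) pmf \<Rightarrow> real \<Rightarrow> nat \<Rightarrow> nat \<Rightarrow> ('v \<Rightarrow> bool) pmf" where
  "alg_output \<mu> \<theta> T1 T2 =
     map_pmf contr (bind_pmf (lift \<theta> (\<lambda>_. True)) (kernel_pow (alg_round \<theta> \<mu> T2) T1))"

end

(*
  Contract the algorithm's state with contr after every outer round. A round started from
  sigma lifts it by drawing exactly the random set S of the field dynamics (the non-star
  coordinates); during the inner loop the stars stay frozen while the remaining coordinates
  perform Glauber dynamics on the tilted measure pinned to 1 on the stars. Hence a round
  differs from a field dynamics step only in replacing the exact pinned resample by T2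
  Glauber steps, which costs at most eps/(2 T1) in total variation. A hybrid argument over
  the T1 rounds adds up to eps/2, and since mu is stationary for the field dynamics (by
  detailed balance), T1 field dynamics steps from the all-ones state are within eps/2 of mu.
*)
theory Submission
  imports Defs
begin

section \<open>Total variation distance\<close>

lemma pmf_bind_finite:
  fixes p :: "'a::finite pmf"
  shows "pmf (bind_pmf p K) y = (\<Sum>x\<in>UNIV. pmf p x * pmf (K x) y)"
  by (simp add: pmf_bind integral_measure_pmf_real[where A=UNIV] mult.commute)

lemma measure_bind_finite:
  fixes p :: "'a::finite pmf" and K :: "'a \<Rightarrow> 'b::finite pmf"
  shows "measure_pmf.prob (bind_pmf p K) B = (\<Sum>x\<in>UNIV. pmf p x * measure_pmf.prob (K x) B)"
  by (simp add: measure_measure_pmf_finite pmf_bind_finite sum_distrib_left sum.swap[of _ B])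

lemma abs_measure_diff_le_tv_dist:
  "\<bar>measure_pmf.prob p A - measure_pmf.prob q A\<bar> \<le> tv_dist p q"
proof -
  have "bdd_above (range (\<lambda>A. \<bar>measure_pmf.prob p A - measure_pmf.prob q A\<bar>))"
    by (rule bdd_aboveI[where M=1])
      (auto simp: abs_le_iff; smt (verit) measure_nonneg measure_pmf.prob_le_1)
  then show ?thesis
    unfolding tv_dist_def by (rule cSUP_upper[rotated]) simp
qed

lemma tv_dist_le:
  "(\<And>A. \<bar>measure_pmf.prob p A - measure_pmf.prob q A\<bar> \<le> b) \<Longrightarrow> tv_dist p q \<le> b"
  unfolding tv_dist_def by (rule cSUP_least) auto

lemma tv_dist_commute: "tv_dist p q = tv_dist q p"
  by (simp add: tv_dist_def abs_minus_commute)

lemma tv_dist_self: "tv_dist p p = 0"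
  using tv_dist_le[of p p 0] abs_measure_diff_le_tv_dist[of p "{}" p] by simp

lemma tv_dist_triangle: "tv_dist p r \<le> tv_dist p q + tv_dist q r"
proof (rule tv_dist_le)
  fix A
  have "\<bar>measure_pmf.prob p A - measure_pmf.prob r A\<bar> \<le>
     \<bar>measure_pmf.prob p A - measure_pmf.prob q A\<bar> + \<bar>measure_pmf.prob q A - measure_pmf.prob r A\<bar>"
    by linarith
  then show "\<bar>measure_pmf.prob p A - measure_pmf.prob r A\<bar> \<le> tv_dist p q + tv_dist q r"
    using abs_measure_diff_le_tv_dist[of p A q] abs_measure_diff_le_tv_dist[of q A r] by linarith
qed

lemma tv_dist_bind_pmf_kernel_le:
  fixes p :: "'a::finite pmf" and K L :: "'a \<Rightarrow> 'b::finite pmf"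
  assumes "\<And>x. x \<in> set_pmf p \<Longrightarrow> tv_dist (K x) (L x) \<le> b"
  shows "tv_dist (bind_pmf p K) (bind_pmf p L) \<le> b"
proof (rule tv_dist_le)
  fix B
  have "\<bar>measure_pmf.prob (bind_pmf p K) B - measure_pmf.prob (bind_pmf p L) B\<bar>
      = \<bar>\<Sum>x\<in>UNIV. pmf p x * (measure_pmf.prob (K x) B - measure_pmf.prob (L x) B)\<bar>"
    by (simp add: measure_bind_finite sum_subtractf right_diff_distrib)
  also have "\<dots> \<le> (\<Sum>x\<in>UNIV. pmf p x * \<bar>measure_pmf.prob (K x) B - measure_pmf.prob (L x) B\<bar>)"
    by (rule order_trans[OF sum_abs]) (simp add: abs_mult)
  also have "\<dots> \<le> (\<Sum>x\<in>UNIV. pmf p x * b)"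
  proof (rule sum_mono)
    fix x
    show "pmf p x * \<bar>measure_pmf.prob (K x) B - measure_pmf.prob (L x) B\<bar> \<le> pmf p x * b"
    proof (cases "x \<in> set_pmf p")
      case True
      then show ?thesis
        using assms[OF True] abs_measure_diff_le_tv_dist[of "K x" B "L x"]
        by (intro mult_left_mono) auto
    next
      case False
      then show ?thesis by (simp add: set_pmf_iff)
    qed
  qed
  also have "\<dots> = b" by (simp add: sum_distrib_right[symmetric] sum_pmf_eq_1)
  finally show "\<bar>measure_pmf.prob (bind_pmf p K) B - measure_pmf.prob (bind_pmf p L) B\<bar> \<le> b" .
qed

lemma sum_pmf_diff_mult_le_tv_dist:
  fixes p q :: "'a::finite pmf"
  assumes "\<And>x. 0 \<le> f x" "\<And>x. f x \<le> 1"
  shows "(\<Sum>x\<in>UNIV. (pmf p x - pmf q x) * f x) \<le> tv_dist p q"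
proof -
  define A where "A = {x. pmf q x < pmf p x}"
  have "(\<Sum>x\<in>UNIV. (pmf p x - pmf q x) * f x) \<le> (\<Sum>x\<in>UNIV. if x \<in> A then pmf p x - pmf q x else 0)"
    using assms by (intro sum_mono) (auto simp: A_def mult_le_0_iff intro: mult_left_le)
  also have "\<dots> = measure_pmf.prob p A - measure_pmf.prob q A"
    by (simp add: sum.If_cases measure_measure_pmf_finite sum_subtractf)
  also have "\<dots> \<le> tv_dist p q" using abs_measure_diff_le_tv_dist[of p A q] by linarith
  finally show ?thesis .
qed

lemma tv_dist_bind_pmf_le:
  fixes p q :: "'a::finite pmf" and K :: "'a \<Rightarrow> 'b::finite pmf"
  shows "tv_dist (bind_pmf p K) (bind_pmf q K) \<le> tv_dist p q"
proof (rule tv_dist_le)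
  fix B
  let ?f = "\<lambda>x. measure_pmf.prob (K x) B"
  have "measure_pmf.prob (bind_pmf p K) B - measure_pmf.prob (bind_pmf q K) B
      = (\<Sum>x\<in>UNIV. (pmf p x - pmf q x) * ?f x)"
    by (simp add: measure_bind_finite sum_subtractf left_diff_distrib)
  moreover have "measure_pmf.prob (bind_pmf q K) B - measure_pmf.prob (bind_pmf p K) B
      = (\<Sum>x\<in>UNIV. (pmf q x - pmf p x) * ?f x)"
    by (simp add: measure_bind_finite sum_subtractf left_diff_distrib)
  ultimately show "\<bar>measure_pmf.prob (bind_pmf p K) B - measure_pmf.prob (bind_pmf q K) B\<bar> \<le> tv_dist p q"
    using sum_pmf_diff_mult_le_tv_dist[of ?f p q] sum_pmf_diff_mult_le_tv_dist[of ?f q p]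
    by (simp add: abs_le_iff tv_dist_commute[of q p])
qed

section \<open>Markov kernels\<close>

lemma set_pmf_kernel_pow_subset:
  assumes "\<And>x. x \<in> S \<Longrightarrow> set_pmf (K x) \<subseteq> S" "x \<in> S"
  shows "set_pmf (kernel_pow K n x) \<subseteq> S"
  by (induction n) (use assms in auto)

lemma map_pmf_kernel_pow:
  assumes "\<And>x. x \<in> S \<Longrightarrow> map_pmf f (K x) = L (f x)"
    and "\<And>x. x \<in> S \<Longrightarrow> set_pmf (K x) \<subseteq> S" and "x \<in> S"
  shows "map_pmf f (kernel_pow K n x) = kernel_pow L n (f x)"
proof (induction n)
  case 0
  then show ?case by simp
next
  case (Suc n)
  have "map_pmf f (kernel_pow K (Suc n) x) = bind_pmf (kernel_pow K n x) (\<lambda>y. L (f y))"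
  proof -
    have "set_pmf (kernel_pow K n x) \<subseteq> S"
      using assms(2,3) by (rule set_pmf_kernel_pow_subset)
    then show ?thesis using assms(1) by (auto simp: map_bind_pmf intro: bind_pmf_cong)
  qed
  also have "\<dots> = kernel_pow L (Suc n) (f x)"
    by (simp add: Suc flip: bind_map_pmf)
  finally show ?case .
qed

lemma tv_dist_kernel_pow_antimono:
  fixes K :: "'a::finite \<Rightarrow> 'a pmf"
  assumes "bind_pmf \<pi> K = \<pi>" "m \<le> n"
  shows "tv_dist (kernel_pow K n x) \<pi> \<le> tv_dist (kernel_pow K m x) \<pi>"
  using assms(2)
proof (induction n rule: dec_induct)
  case (step n)
  have "tv_dist (kernel_pow K (Suc n) x) \<pi> = tv_dist (bind_pmf (kernel_pow K n x) K) (bind_pmf \<pi> K)"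
    using assms(1) by simp
  also have "\<dots> \<le> tv_dist (kernel_pow K n x) \<pi>" by (rule tv_dist_bind_pmf_le)
  finally show ?case using step by linarith
qed simp

lemma tv_dist_kernel_pow_le_of_mix_time:
  fixes K :: "'a::finite \<Rightarrow> 'a pmf"
  assumes "mix_time (kernel_pow K) \<pi> S \<epsilon> \<le> enat T" "x \<in> S" "bind_pmf \<pi> K = \<pi>"
  shows "tv_dist (kernel_pow K T x) \<pi> \<le> \<epsilon>"
proof -
  let ?M = "{t. tv_dist (kernel_pow K t x) \<pi> \<le> \<epsilon>}"
  have "(INF t\<in>?M. enat t) \<le> mix_time (kernel_pow K) \<pi> S \<epsilon>"
    unfolding mix_time_def using assms(2) by (rule SUP_upper)
  then have le_T: "(INF t\<in>?M. enat t) \<le> enat T" using assms(1) by (rule order_trans)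
  have "\<exists>t\<in>?M. t \<le> T"
  proof (rule ccontr)
    assume "\<not> (\<exists>t\<in>?M. t \<le> T)"
    then have "enat (Suc T) \<le> (INF t\<in>?M. enat t)" by (intro INF_greatest) auto
    then have "enat (Suc T) \<le> enat T" using le_T by (rule order_trans)
    then show False by simp
  qed
  then obtain t where "t \<in> ?M" "t \<le> T" by blast
  then show ?thesis using tv_dist_kernel_pow_antimono[OF assms(3), of t T x] by simp
qed

lemma tv_dist_kernel_pow_le:
  fixes K L :: "'a::finite \<Rightarrow> 'a pmf"
  assumes close: "\<And>x. x \<in> S \<Longrightarrow> tv_dist (K x) (L x) \<le> \<delta>"
    and invariant: "\<And>x. x \<in> S \<Longrightarrow> set_pmf (L x) \<subseteq> S" and "x \<in> S"
  shows "tv_dist (kernel_pow K n x) (kernel_pow L n x) \<le> real n * \<delta>"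
proof (induction n)
  case 0
  then show ?case by (simp add: tv_dist_self)
next
  case (Suc n)
  have "tv_dist (bind_pmf (kernel_pow K n x) K) (bind_pmf (kernel_pow L n x) K) \<le> real n * \<delta>"
    using tv_dist_bind_pmf_le Suc by (rule order_trans)
  moreover have "tv_dist (bind_pmf (kernel_pow L n x) K) (bind_pmf (kernel_pow L n x) L) \<le> \<delta>"
  proof (rule tv_dist_bind_pmf_kernel_le)
    have "set_pmf (kernel_pow L n x) \<subseteq> S"
      using invariant \<open>x \<in> S\<close> by (rule set_pmf_kernel_pow_subset)
    then show "tv_dist (K y) (L y) \<le> \<delta>" if "y \<in> set_pmf (kernel_pow L n x)" for y
      using close that by blast
  qed
  ultimately show ?case
    using tv_dist_triangle[of "bind_pmf (kernel_pow K n x) K" "bind_pmf (kernel_pow L n x) L"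
          "bind_pmf (kernel_pow L n x) K"]
    by (simp add: algebra_simps)
qed

lemma bind_pmf_stationary_of_detailed_balance:
  fixes \<mu> :: "'a::finite pmf" and K :: "'a \<Rightarrow> 'b::finite pmf" and L :: "'b \<Rightarrow> 'a pmf"
  assumes balance: "\<And>x y. pmf \<mu> x * pmf (K x) y = \<rho> y * pmf (L y) x"
  shows "bind_pmf \<mu> (\<lambda>x. bind_pmf (K x) L) = \<mu>"
proof (rule pmf_eqI)
  fix z
  have "pmf (bind_pmf \<mu> (\<lambda>x. bind_pmf (K x) L)) z
      = (\<Sum>x\<in>UNIV. \<Sum>y\<in>UNIV. (pmf \<mu> x * pmf (K x) y) * pmf (L y) z)"
    by (simp add: pmf_bind_finite sum_distrib_left mult.assoc)
  also have "\<dots> = (\<Sum>y\<in>UNIV. \<rho> y * pmf (L y) z * (\<Sum>x\<in>UNIV. pmf (L y) x))"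
    by (subst sum.swap) (simp add: balance sum_distrib_left mult_ac)
  also have "\<dots> = (\<Sum>y\<in>UNIV. pmf \<mu> z * pmf (K z) y)"
    by (simp add: sum_pmf_eq_1 balance)
  also have "\<dots> = pmf \<mu> z"
    by (simp add: sum_distrib_left[symmetric] sum_pmf_eq_1)
  finally show "pmf (bind_pmf \<mu> (\<lambda>x. bind_pmf (K x) L)) z = pmf \<mu> z" .
qed

section \<open>Conditioning and Glauber dynamics\<close>

lemma pmf_times_indicator_eq_measure_times_pmf_cond:
  "pmf p x * indicator A x = measure_pmf.prob p A * pmf (cond_pmf p A) x"
proof (cases "set_pmf p \<inter> A = {}")
  case True
  then have "measure_pmf.prob p A = 0" by (simp add: measure_pmf_zero_iff)
  moreover have "pmf p x * indicator A x = 0" using True by (auto simp: set_pmf_iff indicator_def)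
  ultimately show ?thesis by simp
next
  case False
  then show ?thesis by (simp add: pmf_cond measure_measure_pmf_not_zero)
qed

lemma cond_pmf_cond_pmf:
  fixes p :: "'a::finite pmf"
  assumes "set_pmf p \<inter> B \<noteq> {}" "B \<subseteq> A"
  shows "cond_pmf (cond_pmf p A) B = cond_pmf p B"
proof (rule pmf_eqI)
  fix x
  have nA: "set_pmf p \<inter> A \<noteq> {}" using assms by blast
  then have nAB: "set_pmf (cond_pmf p A) \<inter> B \<noteq> {}" using assms by auto
  have "measure_pmf.prob (cond_pmf p A) B = (\<Sum>y\<in>B. pmf p y / measure_pmf.prob p A)"
    using assms(2) by (simp add: measure_measure_pmf_finite pmf_cond[OF nA] subset_iff)
  also have "\<dots> = measure_pmf.prob p B / measure_pmf.prob p A"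
    by (simp add: sum_divide_distrib[symmetric] measure_measure_pmf_finite[of B])
  finally show "pmf (cond_pmf (cond_pmf p A) B) x = pmf (cond_pmf p B) x"
    using assms(2) measure_measure_pmf_not_zero[OF nA]
    by (auto simp: pmf_cond[OF nAB] pmf_cond[OF assms(1)] pmf_cond[OF nA])
qed

lemma gd_step_stationary:
  fixes \<nu> :: "('v::finite \<Rightarrow> bool) pmf"
  shows "bind_pmf \<nu> (gd_step \<nu>) = \<nu>"
proof -
  have site_stationary: "bind_pmf \<nu> (\<lambda>X. map_pmf (\<lambda>Y. X(v := Y v)) (cond_off \<nu> v X)) = \<nu>" for v
  proof -
    let ?R = "\<lambda>X Y. \<forall>u. u \<noteq> v \<longrightarrow> (Y::'v \<Rightarrow> bool) u = X u"
    have "map_pmf (\<lambda>Y. X(v := Y v)) (cond_off \<nu> v X) = cond_pmf \<nu> {Y. ?R X Y}"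
      if "X \<in> set_pmf \<nu>" for X
    proof -
      have "set_pmf \<nu> \<inter> {Y. ?R X Y} \<noteq> {}" using that by blast
      then have "map_pmf (\<lambda>Y. X(v := Y v)) (cond_off \<nu> v X) = map_pmf id (cond_off \<nu> v X)"
        by (intro map_pmf_cong) (auto simp: cond_off_def fun_eq_iff)
      then show ?thesis by (simp add: cond_off_def)
    qed
    then have "bind_pmf \<nu> (\<lambda>X. map_pmf (\<lambda>Y. X(v := Y v)) (cond_off \<nu> v X))
        = bind_pmf \<nu> (\<lambda>X. cond_pmf \<nu> {Y. ?R X Y})"
      by (intro bind_pmf_cong) auto
    also have "\<dots> = \<nu>"
    proof (rule bind_cond_pmf_cancel)
      fix X Y assume "?R X Y"
      then have "{Y'. ?R X Y'} = {X'. ?R X' Y}" by auto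
      then show "measure_pmf.prob \<nu> {Y'. ?R X Y'} = measure_pmf.prob \<nu> {X'. ?R X' Y}" by simp
    qed auto
    finally show ?thesis .
  qed
  have "bind_pmf \<nu> (gd_step \<nu>) = bind_pmf (pmf_of_set UNIV)
      (\<lambda>v. bind_pmf \<nu> (\<lambda>X. map_pmf (\<lambda>Y. X(v := Y v)) (cond_off \<nu> v X)))"
    unfolding gd_step_def by (rule bind_commute_pmf)
  then show ?thesis by (simp add: site_stationary)
qed

lemma cond_off_pin1_outside:
  assumes "x \<in> set_pmf \<nu>" "\<forall>u\<in>\<Lambda>. x u" "v \<notin> \<Lambda>"
  shows "cond_off (pin1 \<nu> \<Lambda>) v x = cond_off \<nu> v x"
  unfolding cond_off_def pin1_def using assms by (intro cond_pmf_cond_pmf) auto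

lemma update_cond_off_pin1_inside:
  assumes "x \<in> set_pmf \<nu>" "\<forall>u\<in>\<Lambda>. x u" "v \<in> \<Lambda>"
  shows "map_pmf (\<lambda>Y. x(v := Y v)) (cond_off (pin1 \<nu> \<Lambda>) v x) = return_pmf x"
proof -
  have "set_pmf \<nu> \<inter> {\<sigma>. \<forall>u\<in>\<Lambda>. \<sigma> u} \<noteq> {}" using assms(1,2) by blast
  then have pinned: "set_pmf (pin1 \<nu> \<Lambda>) = set_pmf \<nu> \<inter> {\<sigma>. \<forall>u\<in>\<Lambda>. \<sigma> u}"
    by (simp add: pin1_def)
  then have "set_pmf (pin1 \<nu> \<Lambda>) \<inter> {Y. \<forall>u. u \<noteq> v \<longrightarrow> Y u = x u} \<noteq> {}"
    using assms(1,2) by blast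
  then have "set_pmf (cond_off (pin1 \<nu> \<Lambda>) v x)
      = set_pmf (pin1 \<nu> \<Lambda>) \<inter> {Y. \<forall>u. u \<noteq> v \<longrightarrow> Y u = x u}"
    by (simp add: cond_off_def)
  then have "map_pmf (\<lambda>Y. x(v := Y v)) (cond_off (pin1 \<nu> \<Lambda>) v x)
      = map_pmf (\<lambda>_. x) (cond_off (pin1 \<nu> \<Lambda>) v x)"
    using assms(2,3) by (intro map_pmf_cong) (auto simp: pinned fun_eq_iff)
  then show ?thesis by simp
qed

section \<open>Tilted measure and field dynamics\<close>

lemma tilt_normalizer_pos:
  fixes \<mu> :: "('v::finite \<Rightarrow> bool) pmf"
  assumes "0 < \<theta>"
  shows "0 < (\<Sum>\<tau>\<in>UNIV. pmf \<mu> \<tau> * \<theta> ^ ones \<tau>)"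
proof -
  obtain \<sigma> where "\<sigma> \<in> set_pmf \<mu>" using set_pmf_not_empty[of \<mu>] by blast
  then have "0 < pmf \<mu> \<sigma> * \<theta> ^ ones \<sigma>" using assms by (simp add: set_pmf_eq')
  also have "\<dots> \<le> (\<Sum>\<tau>\<in>UNIV. pmf \<mu> \<tau> * \<theta> ^ ones \<tau>)"
    using assms by (intro member_le_sum) auto
  finally show ?thesis .
qed

lemma pmf_tilt:
  fixes \<mu> :: "('v::finite \<Rightarrow> bool) pmf"
  assumes "0 < \<theta>"
  shows "pmf (tilt \<theta> \<mu>) \<sigma> = pmf \<mu> \<sigma> * \<theta> ^ ones \<sigma> / (\<Sum>\<tau>\<in>UNIV. pmf \<mu> \<tau> * \<theta> ^ ones \<tau>)"
proof -
  let ?f = "\<lambda>\<sigma>. pmf \<mu> \<sigma> * \<theta> ^ ones \<sigma> / (\<Sum>\<tau>\<in>UNIV. pmf \<mu> \<tau> * \<theta> ^ ones \<tau>)"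
  have Z: "0 < (\<Sum>\<tau>\<in>UNIV. pmf \<mu> \<tau> * \<theta> ^ ones \<tau>)" using assms by (rule tilt_normalizer_pos)
  then have nonneg: "\<And>x. 0 \<le> ?f x" using assms by simp
  have "(\<Sum>x\<in>UNIV. ?f x) = 1" using Z by (simp add: sum_divide_distrib[symmetric])
  then have "(\<integral>\<^sup>+x. ennreal (?f x) \<partial>count_space UNIV) = 1"
    by (simp add: nn_integral_count_space_finite nonneg sum_ennreal)
  then show ?thesis unfolding tilt_def by (rule pmf_embed_pmf[OF nonneg])
qed

lemma set_pmf_tilt:
  fixes \<mu> :: "('v::finite \<Rightarrow> bool) pmf"
  assumes "0 < \<theta>"
  shows "set_pmf (tilt \<theta> \<mu>) = set_pmf \<mu>"
  using tilt_normalizer_pos[OF assms, of \<mu>] assms by (auto simp: set_pmf_eq pmf_tilt)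

definition fd_set_pmf :: "real \<Rightarrow> ('v::finite \<Rightarrow> bool) \<Rightarrow> ('v \<Rightarrow> bool) pmf" where
  "fd_set_pmf \<theta> \<sigma> = Pi_pmf UNIV False (\<lambda>v. if \<sigma> v then bernoulli_pmf \<theta> else return_pmf True)"

lemma fd_step_eq_bind_fd_set_pmf:
  "fd_step \<theta> \<mu> \<sigma> = bind_pmf (fd_set_pmf \<theta> \<sigma>) (\<lambda>S. pin1 (tilt \<theta> \<mu>) {v. \<not> S v})"
  by (simp add: fd_step_def fd_set_pmf_def)

lemma fd_set_pmf_contains_zeros:
  assumes "S \<in> set_pmf (fd_set_pmf \<theta> \<sigma>)" "\<not> \<sigma> v"
  shows "S v"
proof -
  have "S v \<in> set_pmf (if \<sigma> v then bernoulli_pmf \<theta> else return_pmf True)"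
    using assms(1) unfolding fd_set_pmf_def by (auto simp: set_Pi_pmf PiE_dflt_def)
  then show "S v" using assms(2) by simp
qed

lemma prod_UNIV_if_eq_power:
  fixes a :: real
  shows "(\<Prod>v\<in>(UNIV::'v::finite set). if P v then a else 1) = a ^ card {v. P v}"
  by (simp add: prod.If_cases Int_def)

lemma pmf_fd_set_pmf:
  assumes "0 < \<theta>" "\<theta> < 1"
  shows "pmf (fd_set_pmf \<theta> \<sigma>) S
    = ((1 - \<theta>) / \<theta>) ^ card {v. \<not> S v} * \<theta> ^ ones \<sigma> * indicator {\<sigma>. \<forall>v\<in>{v. \<not> S v}. \<sigma> v} \<sigma>"
proof -
  have factors: "pmf (fd_set_pmf \<theta> \<sigma>) S
      = (\<Prod>v\<in>UNIV. if \<sigma> v then (if S v then \<theta> else 1 - \<theta>) else (if S v then 1 else 0))"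
    unfolding fd_set_pmf_def using assms by (subst pmf_Pi) (auto intro!: prod.cong)
  show ?thesis
  proof (cases "\<forall>v. \<not> S v \<longrightarrow> \<sigma> v")
    case False
    then obtain v where "\<not> S v" "\<not> \<sigma> v" by blast
    then have "pmf (fd_set_pmf \<theta> \<sigma>) S = 0" unfolding factors by (intro prod_zero) auto
    then show ?thesis using False by simp
  next
    case True
    let ?k = "card {v. \<sigma> v \<and> S v}" and ?m = "card {v. \<not> S v}"
    have "pmf (fd_set_pmf \<theta> \<sigma>) S
        = (\<Prod>v\<in>UNIV. (if \<sigma> v \<and> S v then \<theta> else 1) * (if \<not> S v then 1 - \<theta> else 1))"
      unfolding factors using True by (intro prod.cong) auto
    also have "\<dots> = \<theta> ^ ?k * (1 - \<theta>) ^ ?m"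
      by (simp only: prod.distrib prod_UNIV_if_eq_power)
    finally have "pmf (fd_set_pmf \<theta> \<sigma>) S = \<theta> ^ ?k * (1 - \<theta>) ^ ?m" .
    moreover have "{v. \<sigma> v} = {v. \<sigma> v \<and> S v} \<union> {v. \<not> S v}" using True by auto
    then have "ones \<sigma> = ?k + ?m"
      unfolding ones_def by (simp add: card_Un_disjoint[symmetric] disjoint_iff)
    ultimately show ?thesis
      using True assms by (simp add: power_add power_divide field_simps)
  qed
qed

text \<open>The factor in front of the pinned measure depends on \<open>S\<close> only, so the field dynamics
  is reversible with respect to \<open>\<mu>\<close>.\<close>
lemma fd_detailed_balance:
  fixes \<mu> :: "('v::finite \<Rightarrow> bool) pmf"
  assumes "0 < \<theta>" "\<theta> < 1"
  defines "Z \<equiv> \<Sum>\<tau>\<in>UNIV. pmf \<mu> \<tau> * \<theta> ^ ones \<tau>"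
  shows "pmf \<mu> \<sigma> * pmf (fd_set_pmf \<theta> \<sigma>) S
    = ((1 - \<theta>) / \<theta>) ^ card {v. \<not> S v} * Z
      * measure_pmf.prob (tilt \<theta> \<mu>) {\<sigma>. \<forall>v\<in>{v. \<not> S v}. \<sigma> v}
      * pmf (pin1 (tilt \<theta> \<mu>) {v. \<not> S v}) \<sigma>"
proof -
  let ?A = "{\<sigma>. \<forall>v\<in>{v. \<not> S v}. \<sigma> v}" and ?c = "((1 - \<theta>) / \<theta>) ^ card {v. \<not> S v}"
  have "0 < Z" unfolding Z_def using assms(1) by (rule tilt_normalizer_pos)
  then have "pmf \<mu> \<sigma> * \<theta> ^ ones \<sigma> = Z * pmf (tilt \<theta> \<mu>) \<sigma>"
    by (simp add: pmf_tilt[OF assms(1)] Z_def)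
  then have "pmf \<mu> \<sigma> * pmf (fd_set_pmf \<theta> \<sigma>) S = ?c * Z * (pmf (tilt \<theta> \<mu>) \<sigma> * indicator ?A \<sigma>)"
    by (simp add: pmf_fd_set_pmf[OF assms(1,2)] mult_ac)
  then show ?thesis
    by (simp add: pmf_times_indicator_eq_measure_times_pmf_cond pin1_def mult_ac)
qed

lemma fd_step_stationary:
  fixes \<mu> :: "('v::finite \<Rightarrow> bool) pmf"
  assumes "0 < \<theta>" "\<theta> < 1"
  shows "bind_pmf \<mu> (fd_step \<theta> \<mu>) = \<mu>"
  unfolding fd_step_eq_bind_fd_set_pmf
  using fd_detailed_balance[OF assms] by (rule bind_pmf_stationary_of_detailed_balance)

lemma set_pmf_fd_step_subset:
  fixes \<mu> :: "('v::finite \<Rightarrow> bool) pmf"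
  assumes "0 < \<theta>" "\<sigma> \<in> set_pmf \<mu>"
  shows "set_pmf (fd_step \<theta> \<mu> \<sigma>) \<subseteq> set_pmf \<mu>"
proof
  fix \<tau> assume "\<tau> \<in> set_pmf (fd_step \<theta> \<mu> \<sigma>)"
  then obtain S where S: "S \<in> set_pmf (fd_set_pmf \<theta> \<sigma>)"
    and \<tau>: "\<tau> \<in> set_pmf (pin1 (tilt \<theta> \<mu>) {v. \<not> S v})"
    by (auto simp: fd_step_eq_bind_fd_set_pmf)
  have "set_pmf (tilt \<theta> \<mu>) \<inter> {\<sigma>. \<forall>v\<in>{v. \<not> S v}. \<sigma> v} \<noteq> {}"
    using fd_set_pmf_contains_zeros[OF S] assms set_pmf_tilt[OF assms(1), of \<mu>] by auto
  then show "\<tau> \<in> set_pmf \<mu>" using \<tau> set_pmf_tilt[OF assms(1), of \<mu>] by (simp add: pin1_def)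
qed

section \<open>The algorithm\<close>

definition lift_config :: "('v \<Rightarrow> bool) \<Rightarrow> ('v \<Rightarrow> bool) \<Rightarrow> ('v \<Rightarrow> spin)" where
  "lift_config \<sigma> S = (\<lambda>v. if \<sigma> v then (if S v then One else Star) else Zero)"

lemma contr_lift_config [simp]: "contr (lift_config \<sigma> S) = \<sigma>"
  by (simp add: contr_def lift_config_def fun_eq_iff)

lemma lift_eq_map_fd_set_pmf: "lift \<theta> \<sigma> = map_pmf (lift_config \<sigma>) (fd_set_pmf \<theta> \<sigma>)"
proof -
  let ?g = "\<lambda>v b. if \<sigma> v then (if b then One else Star) else Zero"
  let ?c = "\<lambda>v. if \<sigma> v then bernoulli_pmf \<theta> else return_pmf True"
  have "lift \<theta> \<sigma> = Pi_pmf UNIV Zero (\<lambda>v. bind_pmf (?c v) (\<lambda>b. return_pmf (?g v b)))"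
    unfolding lift_def
    by (intro arg_cong[where f="Pi_pmf UNIV Zero"] ext) (auto simp: map_pmf_def bind_return_pmf)
  also have "\<dots> = bind_pmf (Pi_pmf UNIV False ?c) (\<lambda>f. Pi_pmf UNIV Zero (\<lambda>v. return_pmf (?g v (f v))))"
    by (rule Pi_pmf_bind) simp
  also have "\<dots> = map_pmf (lift_config \<sigma>) (fd_set_pmf \<theta> \<sigma>)"
    by (simp add: fd_set_pmf_def map_pmf_def lift_config_def)
  finally show ?thesis .
qed

definition round_kernel :: "real \<Rightarrow> ('v::finite \<Rightarrow> bool) pmf \<Rightarrow> nat \<Rightarrow> ('v \<Rightarrow> bool) \<Rightarrow> ('v \<Rightarrow> bool) pmf" where
  "round_kernel \<theta> \<mu> T2 \<sigma> = map_pmf contr (bind_pmf (lift \<theta> \<sigma>) (kernel_pow (alg_step \<theta> \<mu>) T2))"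

lemma alg_output_eq_kernel_pow_round_kernel:
  fixes \<mu> :: "('v::finite \<Rightarrow> bool) pmf"
  shows "alg_output \<mu> \<theta> T1 T2 = kernel_pow (round_kernel \<theta> \<mu> T2) T1 (\<lambda>_. True)"
proof -
  have "map_pmf contr (kernel_pow (alg_round \<theta> \<mu> T2) T1 X) = kernel_pow (round_kernel \<theta> \<mu> T2) T1 (contr X)"
    for X
    by (rule map_pmf_kernel_pow[where S = UNIV]) (simp_all add: alg_round_def round_kernel_def)
  moreover have "map_pmf contr (lift \<theta> \<sigma>) = return_pmf \<sigma>" for \<sigma> :: "'v \<Rightarrow> bool"
    by (simp add: lift_eq_map_fd_set_pmf pmf.map_comp o_def)
  ultimately show ?thesis
    by (simp add: alg_output_def map_bind_pmf bind_return_pmf flip: bind_map_pmf)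
qed

definition frozen_stars :: "real \<Rightarrow> ('v::finite \<Rightarrow> bool) pmf \<Rightarrow> 'v set \<Rightarrow> ('v \<Rightarrow> spin) \<Rightarrow> bool" where
  "frozen_stars \<theta> \<mu> \<Lambda> X \<longleftrightarrow> {v. X v = Star} = \<Lambda> \<and> contr X \<in> set_pmf (tilt \<theta> \<mu>)"

lemma contr_update: "contr (X(v := (if b then One else Zero))) = (contr X)(v := b)"
  by (auto simp: contr_def fun_eq_iff)

lemma map_contr_alg_step:
  assumes "frozen_stars \<theta> \<mu> \<Lambda> X"
  shows "map_pmf contr (alg_step \<theta> \<mu> X) = gd_step (pin1 (tilt \<theta> \<mu>) \<Lambda>) (contr X)"
proof -
  have support: "contr X \<in> set_pmf (tilt \<theta> \<mu>)" and pinned: "\<forall>u\<in>\<Lambda>. contr X u"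
    using assms by (auto simp: frozen_stars_def contr_def)
  show ?thesis unfolding alg_step_def gd_step_def map_bind_pmf
  proof (intro bind_pmf_cong refl)
    fix v
    show "map_pmf contr (if X v = Star then return_pmf X
          else map_pmf (\<lambda>Y. X(v := if Y v then One else Zero)) (cond_off (tilt \<theta> \<mu>) v (contr X)))
        = map_pmf (\<lambda>Y. (contr X)(v := Y v)) (cond_off (pin1 (tilt \<theta> \<mu>) \<Lambda>) v (contr X))"
    proof (cases "X v = Star")
      case True
      then have "v \<in> \<Lambda>" using assms by (auto simp: frozen_stars_def)
      then show ?thesis using True update_cond_off_pin1_inside[OF support pinned] by simp
    next
      case False
      then have "v \<notin> \<Lambda>" using assms by (auto simp: frozen_stars_def)
      then show ?thesis
        using False cond_off_pin1_outside[OF support pinned] by (simp add: pmf.map_comp o_def contr_update)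
    qed
  qed
qed

lemma alg_step_preserves_frozen_stars:
  assumes "frozen_stars \<theta> \<mu> \<Lambda> X" "Y \<in> set_pmf (alg_step \<theta> \<mu> X)"
  shows "frozen_stars \<theta> \<mu> \<Lambda> Y"
proof -
  obtain v where Y: "Y \<in> set_pmf (if X v = Star then return_pmf X
      else map_pmf (\<lambda>Y. X(v := if Y v then One else Zero)) (cond_off (tilt \<theta> \<mu>) v (contr X)))"
    using assms(2) by (auto simp: alg_step_def)
  show ?thesis
  proof (cases "X v = Star")
    case True
    then show ?thesis using Y assms(1) by simp
  next
    case False
    have "set_pmf (tilt \<theta> \<mu>) \<inter> {Z. \<forall>u. u \<noteq> v \<longrightarrow> Z u = contr X u} \<noteq> {}"
      using assms(1) by (auto simp: frozen_stars_def)
    with Y False obtain Z where Z: "Z \<in> set_pmf (tilt \<theta> \<mu>)" "\<forall>u. u \<noteq> v \<longrightarrow> Z u = contr X u"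
      and YZ: "Y = X(v := if Z v then One else Zero)"
      by (auto simp: cond_off_def)
    have "contr Y = (contr X)(v := Z v)" using YZ by (simp add: contr_update)
    then have "contr Y = Z" using Z(2) by (auto simp: fun_eq_iff)
    moreover have "{u. Y u = Star} = {u. X u = Star}" using YZ False by auto
    ultimately show ?thesis using assms(1) Z(1) by (simp add: frozen_stars_def)
  qed
qed

lemma map_contr_kernel_pow_alg_step:
  assumes "frozen_stars \<theta> \<mu> \<Lambda> X"
  shows "map_pmf contr (kernel_pow (alg_step \<theta> \<mu>) n X)
    = kernel_pow (gd_step (pin1 (tilt \<theta> \<mu>) \<Lambda>)) n (contr X)"
  using assms
  by (intro map_pmf_kernel_pow[where S = "Collect (frozen_stars \<theta> \<mu> \<Lambda>)"])
    (auto intro: map_contr_alg_step alg_step_preserves_frozen_stars)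

lemma round_kernel_eq_bind_fd_set_pmf:
  "round_kernel \<theta> \<mu> T2 \<sigma>
    = bind_pmf (fd_set_pmf \<theta> \<sigma>) (\<lambda>S. map_pmf contr (kernel_pow (alg_step \<theta> \<mu>) T2 (lift_config \<sigma> S)))"
  by (simp add: round_kernel_def lift_eq_map_fd_set_pmf bind_map_pmf map_bind_pmf)

lemma tv_dist_round_kernel_fd_step_le:
  fixes \<mu> :: "('v::finite \<Rightarrow> bool) pmf"
  assumes "0 < \<theta>" "\<sigma> \<in> set_pmf \<mu>" "T_tilted \<mu> \<theta> \<delta> \<le> enat T2"
  shows "tv_dist (round_kernel \<theta> \<mu> T2 \<sigma>) (fd_step \<theta> \<mu> \<sigma>) \<le> \<delta>"
  unfolding round_kernel_eq_bind_fd_set_pmf fd_step_eq_bind_fd_set_pmf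
proof (rule tv_dist_bind_pmf_kernel_le)
  fix S assume S: "S \<in> set_pmf (fd_set_pmf \<theta> \<sigma>)"
  define \<Lambda> where "\<Lambda> = {v. \<not> S v}"
  let ?\<nu> = "pin1 (tilt \<theta> \<mu>) \<Lambda>"
  have pinned: "\<sigma> \<in> {\<sigma>. \<forall>v\<in>\<Lambda>. \<sigma> v}" using fd_set_pmf_contains_zeros[OF S] by (auto simp: \<Lambda>_def)
  have support: "\<sigma> \<in> set_pmf (tilt \<theta> \<mu>)" using assms(1,2) by (simp add: set_pmf_tilt)
  have "{v. lift_config \<sigma> S v = Star} = \<Lambda>"
    using pinned by (auto simp: lift_config_def \<Lambda>_def)
  then have "frozen_stars \<theta> \<mu> \<Lambda> (lift_config \<sigma> S)"
    using support by (simp add: frozen_stars_def)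
  then have inner_loop: "map_pmf contr (kernel_pow (alg_step \<theta> \<mu>) T2 (lift_config \<sigma> S))
      = kernel_pow (gd_step ?\<nu>) T2 \<sigma>"
    by (simp add: map_contr_kernel_pow_alg_step)
  have "marg1 \<mu> \<Lambda> > 0"
    unfolding marg1_def using assms(2) pinned by (rule measure_pmf_posI)
  then have "T_GD ?\<nu> \<delta> \<le> enat T2"
    using assms(3) unfolding T_tilted_def by (auto simp: SUP_le_iff)
  then have "tv_dist (kernel_pow (gd_step ?\<nu>) T2 \<sigma>) ?\<nu> \<le> \<delta>"
    unfolding T_GD_def
  proof (rule tv_dist_kernel_pow_le_of_mix_time)
    show "\<sigma> \<in> set_pmf ?\<nu>"
      unfolding pin1_def using pinned support by (subst set_cond_pmf) auto
  qed (rule gd_step_stationary)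
  then show "tv_dist (map_pmf contr (kernel_pow (alg_step \<theta> \<mu>) T2 (lift_config \<sigma> S)))
      (pin1 (tilt \<theta> \<mu>) {v. \<not> S v}) \<le> \<delta>"
    by (simp add: inner_loop \<Lambda>_def)
qed

theorem lemma3p1:
  fixes \<mu> :: "('v::finite \<Rightarrow> bool) pmf" and \<theta> \<epsilon> :: real and T1 T2 :: nat
  assumes "0 < \<theta>" "\<theta> < 1" "0 < \<epsilon>" "\<epsilon> < 1"
    and "pmf \<mu> (\<lambda>_. True) > 0"
    and "enat T1 \<ge> T_FD \<mu> \<theta> (\<epsilon> / 2)"
    and "enat T2 \<ge> T_tilted \<mu> \<theta> (\<epsilon> / (2 * real T1))"
  shows "tv_dist (alg_output \<mu> \<theta> T1 T2) \<mu> \<le> \<epsilon>"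
proof -
  let ?P = "fd_step \<theta> \<mu>" and ?Q = "round_kernel \<theta> \<mu> T2" and ?one = "\<lambda>_::'v. True"
  have one: "?one \<in> set_pmf \<mu>" using assms(5) by (simp add: set_pmf_iff)
  have fd_mixed: "tv_dist (kernel_pow ?P T1 ?one) \<mu> \<le> \<epsilon> / 2"
    using assms(6)[unfolded T_FD_def] one fd_step_stationary[OF assms(1,2)]
    by (rule tv_dist_kernel_pow_le_of_mix_time)
  have "tv_dist (kernel_pow ?Q T1 ?one) (kernel_pow ?P T1 ?one) \<le> real T1 * (\<epsilon> / (2 * real T1))"
    using tv_dist_round_kernel_fd_step_le[OF assms(1) _ assms(7)] set_pmf_fd_step_subset[OF assms(1)] one
    by (rule tv_dist_kernel_pow_le)
  also have "\<dots> \<le> \<epsilon> / 2" \<comment> \<open>an equality unless \<open>T1 = 0\<close>, where \<open>x / 0 = 0\<close>\<close>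
    using assms(3) by (cases "T1 = 0") auto
  finally have rounds_close: "tv_dist (kernel_pow ?Q T1 ?one) (kernel_pow ?P T1 ?one) \<le> \<epsilon> / 2" .
  show ?thesis
    using tv_dist_triangle[of "kernel_pow ?Q T1 ?one" \<mu> "kernel_pow ?P T1 ?one"] rounds_close fd_mixed
    by (simp add: alg_output_eq_kernel_pow_round_kernel)
qed

end
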